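(* Let $f(x)\in\mathbb{Z}[x]$ have degree at least $2$ and let $t\in\mathbb{Z}$ be a wandering point for $f$. Given $\epsilon>0$, there exist an integer $k(\epsilon)>1$ and linear polynomials $g_1(x),\dots,g_{k(\epsilon)}(x)$ with integer coefficients such that $$1-\epsilon\le \delta_{f,t}\left(\bigcup_{i=1}^{k(\epsilon)}\operatorname{Orb}^{\pm}_{g_i}(t)\right)<1.$$
   Context: $\operatorname{Orb}_f(t)=\{f^n(t):n\ge0\}$ ($f^0(x)=x$, $f^n=f\circ f^{n-1}$); $t$ is wandering if this set is infinite. For a degree-one polynomial $g$ with rational coefficients (a bijection of $\mathbb{Q}$), $\operatorname{Orb}^{\pm}_g(t)=\{g^n(t):n\in\mathbb{Z}\}$, negative iterates being iterates of the inverse map; for $g(x)=x+a$ this is $\{t+na:n\in\mathbb{Z}\}$. For $A\subseteq\mathbb{Q}$, $$\delta_{f,t}(A)=\lim_{X\to\infty}\frac{|\{x\in A\cap \operatorname{Orb}_f(t): x\le X\}|}{|\{x\in\operatorname{Orb}_f(t): x\le X\}|},$$ provided this limit exists.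
   Formalization: When the orbit is unbounded below (e.g. f = -x^2-2, t = 0), the sets {x in Orb_f(t): x ≤ X} are infinite and the quotient defining δ is undefined; in that case only, the orbit is truncated by |x| ≤ X instead of x ≤ X. *)

theory Defs
  imports Complex_Main "HOL-Computational_Algebra.Polynomial"
begin

definition orb :: "'a::comm_semiring_0 poly \<Rightarrow> 'a \<Rightarrow> 'a set" where
  "orb f t = {(poly f ^^ n) t | n. True}"

definition wandering :: "'a::comm_semiring_0 poly \<Rightarrow> 'a \<Rightarrow> bool" where
  "wandering f t \<longleftrightarrow> infinite (orb f t)"

definition int_iterate :: "('a \<Rightarrow> 'a) \<Rightarrow> int \<Rightarrow> 'a \<Rightarrow> 'a" where
  "int_iterate h n = (if 0 \<le> n then h ^^ nat n else inv h ^^ nat (- n))"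

text \<open>Only meaningful when \<^term>\<open>degree g = 1\<close>, so that \<^term>\<open>poly g\<close> is a bijection of the
  rationals and \<^term>\<open>inv (poly g)\<close> is its inverse map.\<close>

definition orb_pm :: "rat poly \<Rightarrow> rat \<Rightarrow> rat set" where
  "orb_pm g t = {int_iterate (poly g) n t | n. True}"

text \<open>The truncated orbit is \<open>{x \<in> orb f t. x \<le> X}\<close>. If the orbit is not bounded below (for
  instance if \<open>f\<close> has negative leading coefficient), that set is infinite and the
  quotient defining the density would be infinity over infinity; in this case only, the orbit is
  truncated by absolute value.\<close>

definition orb_upto :: "rat poly \<Rightarrow> rat \<Rightarrow> real \<Rightarrow> rat set" where
  "orb_upto f t X =
     (if finite {x \<in> orb f t. of_rat x \<le> X}
      then {x \<in> orb f t. of_rat x \<le> X}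
      else {x \<in> orb f t. \<bar>of_rat x\<bar> \<le> X})"

text \<open>\<open>has_orb_density f t A d\<close>: the limit defining the density of \<open>A\<close> in the orbit exists and
  equals \<open>d\<close>.\<close>

definition has_orb_density :: "rat poly \<Rightarrow> rat \<Rightarrow> rat set \<Rightarrow> real \<Rightarrow> bool" where
  "has_orb_density f t A d \<longleftrightarrow>
     ((\<lambda>X. real (card (A \<inter> orb_upto f t X)) / real (card (orb_upto f t X))) \<longlongrightarrow> d) at_top"

lemma orb_pm_translation: "orb_pm [:a, 1:] t = {t + of_int n * a | n. True}"
proof -
  have p: "poly [:a, 1:] = (\<lambda>x. x + a)"
    by (auto simp: add.commute)
  have i: "inv (\<lambda>x. x + a) = (\<lambda>x. x - a)"
    by (rule inv_equality) auto
  have f: "((\<lambda>x. x + a) ^^ n) x = x + of_nat n * a" for n x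
    by (induction n) (auto simp: algebra_simps)
  have b: "((\<lambda>x. x - a) ^^ n) x = x - of_nat n * a" for n x
    by (induction n) (auto simp: algebra_simps)
  have "int_iterate (poly [:a, 1:]) n t = t + of_int n * a" for n
    unfolding int_iterate_def p i by (auto simp: f b)
  then show ?thesis
    by (simp add: orb_pm_def)
qed

end

theory Submission
  imports Defs "HOL-Number_Theory.Totient" "HOL-Analysis.Summation_Tests"
begin

text \<open>Put \<open>a\<^sub>p = f\<^sup>p(t) - t\<close>. For every large \<open>p\<close>, the orbit of \<open>t\<close> modulo \<open>a\<^sub>p\<close> has exact period \<open>p\<close>,
  so \<open>f\<^sup>n(t)\<close> lies in \<open>t + a\<^sub>p \<int>\<close>, the two-sided orbit of \<open>t\<close> under \<open>x + a\<^sub>p\<close>, iff \<open>p\<close> divides \<open>n\<close>. For a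
  finite set \<open>P\<close> of large primes the union of these orbits therefore has density
  \<open>1 - (\<Prod>p\<in>P. 1 - 1/p)\<close>, which is less than 1 and tends to 1 as \<open>P\<close> grows, because the Euler
  product dominates the harmonic series.\<close>

section \<open>Densities of multiples of primes\<close>

text \<open>Induction on \<open>P\<close>: writing \<open>a = p ^ k a * b a\<close> with
  \<open>b a\<close> prime to \<open>p\<close> embeds \<open>A\<close> into the product of the set
  of exponents and the set of cofactors, and the cofactors have all their prime factors in the
  smaller set. The terms are nonnegative, so extending the sum to the full product only increases
  it, and there it splits into a piece of a geometric series and a sum covered by the induction
  hypothesis.\<close>

lemma sum_inverse_le_euler_prod:
  fixes P A :: "nat set"
  assumes "finite P" "\<And>p. p \<in> P \<Longrightarrow> prime p"
    and "finite A" "\<And>a. a \<in> A \<Longrightarrow> a > 0" "\<And>a. a \<in> A \<Longrightarrow> prime_factors a \<subseteq> P"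
  shows "(\<Sum>a\<in>A. 1 / real a) \<le> (\<Prod>p\<in>P. 1 / (1 - 1 / real p))"
  using assms
proof (induction P arbitrary: A rule: finite_induct)
  case empty
  have "a = 1" if "a \<in> A" for a
    using empty.prems(3,4)[OF that] by (simp add: prime_factorization_empty_iff)
  then have "A \<subseteq> {1}" by blast
  then have "(\<Sum>a\<in>A. 1 / real a) \<le> (\<Sum>a\<in>{1}. 1 / real a)"
    by (intro sum_mono2) auto
  then show ?case by simp
next
  case (insert p P)
  have p: "prime p" using insert.prems by blast
  define k where "k a = multiplicity p a" for a
  define b where "b a = a div p ^ k a" for a
  have ab: "a = p ^ k a * b a" for a
    by (simp add: b_def k_def multiplicity_dvd)
  have b_pos: "b a > 0" if "a \<in> A" for a
    using ab[of a] insert.prems(3)[OF that] by (metis gr0I mult_0_right)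
  have b_factors: "prime_factors (b a) \<subseteq> P" if a: "a \<in> A" for a
  proof
    fix q assume q: "q \<in> prime_factors (b a)"
    then have "prime q" "q dvd b a" by (auto simp: in_prime_factors_iff)
    then have "q dvd a" using ab[of a] by (metis dvd_mult)
    then have "q \<in> prime_factors a"
      using \<open>prime q\<close> insert.prems(3)[OF a] by (auto simp: in_prime_factors_iff)
    then have "q \<in> insert p P" using insert.prems(4)[OF a] by blast
    moreover have "\<not> p dvd b a"
      unfolding b_def k_def
      using p insert.prems(3)[OF a] by (intro multiplicity_decompose) auto
    ultimately show "q \<in> P" using \<open>q dvd b a\<close> by auto
  qed
  define h where "h a = (k a, b a)" for a
  have inj: "inj_on h A"
    by (rule inj_onI) (metis ab h_def prod.inject)
  have p1: "real p > 1" using prime_gt_1_nat[OF p] by simp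
  have geo: "(\<Sum>j\<in>k ` A. (1 / real p) ^ j) \<le> 1 / (1 - 1 / real p)"
  proof -
    have "(\<Sum>j\<in>k ` A. (1 / real p) ^ j) \<le> (\<Sum>j. (1 / real p) ^ j)"
      using p1 insert.prems(2) by (intro sum_le_suminf summable_geometric) auto
    also have "\<dots> = 1 / (1 - 1 / real p)"
      using p1 by (intro suminf_geometric) auto
    finally show ?thesis .
  qed
  have IH: "(\<Sum>c\<in>b ` A. 1 / real c) \<le> (\<Prod>p\<in>P. 1 / (1 - 1 / real p))"
  proof (rule insert.IH)
    show "prime_factors c \<subseteq> P" if "c \<in> b ` A" for c
      using that b_factors by blast
  qed (use insert.prems b_pos in auto)
  have "(\<Sum>a\<in>A. 1 / real a) = (\<Sum>a\<in>A. case h a of (j, c) \<Rightarrow> (1 / real p) ^ j * (1 / real c))"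
  proof (intro sum.cong refl)
    fix a assume "a \<in> A"
    have "real a = real p ^ k a * real (b a)"
      by (subst ab) simp
    then show "1 / real a = (case h a of (j, c) \<Rightarrow> (1 / real p) ^ j * (1 / real c))"
      by (simp add: h_def power_one_over)
  qed
  also have "\<dots> = (\<Sum>(j, c)\<in>h ` A. (1 / real p) ^ j * (1 / real c))"
    using inj by (simp add: sum.reindex)
  also have "\<dots> \<le> (\<Sum>(j, c)\<in>k ` A \<times> b ` A. (1 / real p) ^ j * (1 / real c))"
    using insert.prems(2) by (intro sum_mono2) (auto simp: h_def)
  also have "\<dots> = (\<Sum>j\<in>k ` A. (1 / real p) ^ j) * (\<Sum>c\<in>b ` A. 1 / real c)"
    by (simp add: sum_product sum.cartesian_product)
  also have "\<dots> \<le> 1 / (1 - 1 / real p) * (\<Prod>p\<in>P. 1 / (1 - 1 / real p))"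
    using geo IH p1 by (intro mult_mono) (auto intro: sum_nonneg)
  also have "\<dots> = (\<Prod>p\<in>insert p P. 1 / (1 - 1 / real p))"
    using insert.hyps by simp
  finally show ?case .
qed

lemma harmonic_unbounded: "\<exists>N. (\<Sum>n\<in>{1..N}. 1 / real n) > C"
proof (rule ccontr)
  assume "\<not> ?thesis"
  then have C: "(\<Sum>n\<in>{1..N}. 1 / real n) \<le> C" for N by (auto simp: not_less)
  have "summable (\<lambda>n. inverse (real n))"
  proof (rule summableI_nonneg_bounded)
    fix N
    have "(\<Sum>n<N. inverse (real n)) \<le> (\<Sum>n\<in>insert 0 {1..N}. inverse (real n))"
      by (intro sum_mono2) auto
    also have "\<dots> \<le> C" using C[of N] by (simp add: inverse_eq_divide)
    finally show "(\<Sum>n<N. inverse (real n)) \<le> C" .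
  qed auto
  then show False using not_summable_harmonic by blast
qed

text \<open>Every \<open>n \<le> N\<close> factors over the primes below \<open>M\<close> together
  with those in the interval from \<open>M\<close> to \<open>N\<close>, so the two Euler products
  jointly dominate the harmonic sum. The primes below \<open>M\<close> contribute only the fixed
  factor \<open>1 / c\<close>, hence the others must account for the divergence.\<close>

lemma ex_primes_prod_less:
  fixes M :: nat and e :: real
  assumes "e > 0"
  shows "\<exists>P. finite P \<and> (\<forall>p\<in>P. prime p \<and> p \<ge> M) \<and> (\<Prod>p\<in>P. 1 - 1 / real p) < e"
proof -
  define c where "c = (\<Prod>p | prime p \<and> p < M. 1 - 1 / real p)"
  have factor_pos: "1 - 1 / real p > 0" if "prime p" for p :: nat
    using prime_gt_1_nat[OF that] by simp
  have c: "c > 0" unfolding c_def using factor_pos by (intro prod_pos) blast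
  \<comment> \<open>The threshold is chosen so that \<open>1 / (c * e) < 1 / (c * \<pi>)\<close>
    comes out at the end, which is \<open>\<pi> < e\<close>.\<close>
  obtain N where N: "(\<Sum>n\<in>{1..N}. 1 / real n) > 1 / (c * e)"
    using harmonic_unbounded by blast
  define Q where "Q = {p. prime p \<and> p < M}"
  define P where "P = {p. prime p \<and> p \<ge> M \<and> p \<le> N}"
  define \<pi> where "\<pi> = (\<Prod>p\<in>P. 1 - 1 / real p)"
  have fin: "finite Q" "finite P" by (auto simp: Q_def P_def)
  have pos: "\<pi> > 0" unfolding \<pi>_def P_def using factor_pos by (intro prod_pos) blast
  have "1 / (c * e) < (\<Sum>n\<in>{1..N}. 1 / real n)" by (fact N)
  also have "\<dots> \<le> (\<Prod>p\<in>Q \<union> P. 1 / (1 - 1 / real p))"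
  proof (rule sum_inverse_le_euler_prod)
    fix a assume "a \<in> {1..N}"
    then show "prime_factors a \<subseteq> Q \<union> P"
      by (auto simp: Q_def P_def in_prime_factors_iff dest!: dvd_imp_le)
  qed (use fin in \<open>auto simp: Q_def P_def\<close>)
  also have "\<dots> = (\<Prod>p\<in>Q. 1 / (1 - 1 / real p)) * (\<Prod>p\<in>P. 1 / (1 - 1 / real p))"
    using fin by (intro prod.union_disjoint) (auto simp: Q_def P_def)
  also have "\<dots> = 1 / (c * \<pi>)"
    by (simp add: prod_dividef c_def \<pi>_def Q_def)
  finally have "\<pi> < e"
    using c pos assms by (simp add: field_simps)
  then show ?thesis
    using fin by (intro exI[of _ P]) (auto simp: P_def \<pi>_def)
qed

text \<open>The deviation \<open>h\<close> of the counting function from the line of slope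
  \<open>c / L\<close> is itself \<open>L\<close>-periodic, hence bounded, and so vanishes after
  division by \<open>N\<close>.\<close>

lemma periodic_density:
  fixes Q :: "nat \<Rightarrow> bool"
  assumes L: "L > 0" and per: "\<And>n. Q (n + L) = Q n"
  shows "(\<lambda>N. real (card {n. n < N \<and> Q n}) / real N)
    \<longlonglongrightarrow> real (card {n. n < L \<and> Q n}) / real L"
proof -
  define c where "c = card {n. n < L \<and> Q n}"
  define cnt where "cnt N = card {n. n < N \<and> Q n}" for N
  have shift: "cnt (N + L) = cnt N + c" for N
  proof (induction N)
    case 0
    then show ?case by (simp add: cnt_def c_def)
  next
    case (Suc N)
    have step: "cnt (Suc m) = cnt m + (if Q m then 1 else 0)" for m
    proof -
      have "{n. n < Suc m \<and> Q n} = (if Q m then insert m {n. n < m \<and> Q n} else {n. n < m \<and> Q n})"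
        by (auto simp: less_Suc_eq)
      then show ?thesis by (simp add: cnt_def)
    qed
    show ?case using Suc step[of N] step[of "N + L"] per[of N] by simp
  qed
  define h where "h N = real (cnt N) - real N * (real c / real L)" for N
  have h_shift: "h (N + L) = h N" for N
    using L unfolding h_def shift by (simp add: add_divide_distrib distrib_right)
  have h_mult: "h (m + j * L) = h m" for m j
  proof (induction j)
    case (Suc j)
    have "h (m + Suc j * L) = h ((m + j * L) + L)" by (simp add: algebra_simps)
    then show ?case using h_shift Suc by simp
  qed simp
  have h_mod: "h N = h (N mod L)" for N
    using h_mult[of "N mod L" "N div L"] by simp
  define B where "B = Max ((\<lambda>n. \<bar>h n\<bar>) ` {..<L})"
  have B: "\<bar>h N\<bar> \<le> B" for N
    unfolding B_def using L by (subst h_mod) (intro Max_ge, auto)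
  have "(\<lambda>N. h N / real N) \<longlonglongrightarrow> 0"
  proof (rule Lim_null_comparison)
    show "\<forall>\<^sub>F N in sequentially. norm (h N / real N) \<le> B / real N"
      using B by (intro always_eventually) (auto intro!: divide_right_mono)
    show "(\<lambda>N. B / real N) \<longlonglongrightarrow> 0"
      by (rule lim_const_over_n)
  qed
  then have "(\<lambda>N. h N / real N + real c / real L) \<longlonglongrightarrow> 0 + real c / real L"
    by (intro tendsto_intros)
  \<comment> \<open>\<open>N = 0\<close> has to be excluded: there the right side is 0 by the
    convention for division by zero, while the left side is \<open>c / L\<close>.\<close>
  moreover have "\<forall>\<^sub>F N in sequentially. h N / real N + real c / real L = real (cnt N) / real N"
    using eventually_gt_at_top[of 0] by eventually_elim (use L in \<open>simp add: h_def field_simps\<close>)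
  ultimately show ?thesis
    unfolding cnt_def c_def by (simp add: tendsto_cong)
qed

text \<open>With \<open>L\<close> the product of \<open>P\<close>, having a divisor in
  \<open>P\<close> means not being coprime to \<open>L\<close>. This condition is
  \<open>L\<close>-periodic and holds for \<open>L - totient L\<close> residues, and Euler's formula
  for the totient gives the product.\<close>

lemma density_multiples_of_primes:
  fixes P :: "nat set"
  assumes "finite P" "\<And>p. p \<in> P \<Longrightarrow> prime p" "P \<noteq> {}"
  shows "(\<lambda>N. real (card {n. n < N \<and> (\<exists>p\<in>P. p dvd n)}) / real N)
    \<longlonglongrightarrow> 1 - (\<Prod>p\<in>P. 1 - 1 / real p)"
proof -
  define L where "L = \<Prod>P"
  have L: "L > 0" unfolding L_def using assms(2) by (intro prod_pos) (auto intro: prime_gt_0_nat)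
  have pf: "prime_factors L = P"
    unfolding L_def using assms
    by (subst prime_factors_prod) (auto simp: prime_prime_factors dest: assms(2))
  have iff: "(\<exists>p\<in>P. p dvd n) \<longleftrightarrow> \<not> coprime n L" for n
  proof
    assume "\<exists>p\<in>P. p dvd n"
    then obtain p where "p \<in> P" "p dvd n" by blast
    then have "p dvd n" "p dvd L" "\<not> is_unit p"
      using assms(1) assms(2)[of p] by (auto simp: L_def dvd_prodI)
    then show "\<not> coprime n L" using not_coprimeI by blast
  next
    assume "\<not> coprime n L"
    then obtain p where "prime p" "p dvd n" "p dvd L"
      using L prime_factor_nat[of "gcd n L"] by (auto simp: coprime_iff_gcd_eq_1)
    then have "p \<in> prime_factors L" using L by (auto simp: in_prime_factors_iff)
    then show "\<exists>p\<in>P. p dvd n" using pf \<open>p dvd n\<close> by blast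
  qed
  \<comment> \<open>Totatives range over 1 to \<open>L\<close>, while the count runs from 0 to
    \<open>L - 1\<close>. For \<open>L > 1\<close> neither 0 nor \<open>L\<close> is coprime to
    \<open>L\<close>, so the two ranges agree.\<close>
  have L1: "L > 1"
  proof -
    obtain p where "p \<in> P" using assms(3) by blast
    then have "p dvd L" "p > 1" using assms(1) prime_gt_1_nat[OF assms(2)[of p]] by (auto simp: L_def dvd_prodI)
    then show ?thesis using L by (meson dvd_imp_le less_le_trans)
  qed
  have "{n. n < L \<and> \<not> coprime n L} = {..<L} - totatives L"
    using L1 by (auto simp: in_totatives_iff intro: gr0I)
  moreover have "totatives L \<subseteq> {..<L}" using totatives_less L1 by auto
  ultimately have "card {n. n < L \<and> \<not> coprime n L} = L - totient L"
    by (simp add: card_Diff_subset totient_def)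
  then have "real (card {n. n < L \<and> \<not> coprime n L}) = real L - real (totient L)"
    by (simp add: of_nat_diff totient_le)
  also have "\<dots> = real L * (1 - (\<Prod>p\<in>P. 1 - 1 / real p))"
    by (simp add: totient_formula2 pf algebra_simps)
  finally have "real (card {n. n < L \<and> \<not> coprime n L}) / real L = 1 - (\<Prod>p\<in>P. 1 - 1 / real p)"
    using L by simp
  moreover have "coprime (n + L) L = coprime n L" for n
    by (simp add: coprime_iff_gcd_eq_1)
  ultimately show ?thesis
    using periodic_density[OF L, of "\<lambda>n. \<not> coprime n L"] by (simp add: iff)
qed

section \<open>Integer polynomial orbits\<close>

lemma minus_dvd_poly_minus:
  fixes f :: "'a::comm_ring_1 poly"
  shows "x - y dvd poly f x - poly f y"
proof (induction f)
  case (pCons a f)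
  have "poly (pCons a f) x - poly (pCons a f) y = (x - y) * poly f x + y * (poly f x - poly f y)"
    by (simp add: algebra_simps)
  then show ?case using pCons by (metis dvd_add dvd_mult dvd_triv_left)
qed simp

text \<open>This lets \<open>f\<close> act on residue classes modulo \<open>a\<close>, so that an
  orbit can be followed modulo \<open>a\<close>.\<close>

lemma minus_dvd_poly_funpow_minus:
  fixes f :: "'a::comm_ring_1 poly"
  assumes "a dvd x - y"
  shows "a dvd (poly f ^^ n) x - (poly f ^^ n) y"
proof (induction n)
  case (Suc n)
  then have "a dvd poly f ((poly f ^^ n) x) - poly f ((poly f ^^ n) y)"
    using minus_dvd_poly_minus by (rule dvd_trans)
  then show ?case by simp
qed (use assms in simp)

lemma poly_of_int_map_poly:
  "poly (map_poly of_int f) (of_int x :: 'a::comm_ring_1) = of_int (poly f x)"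
  by (induction f) (simp_all add: map_poly_pCons)

text \<open>Write \<open>f\<close> as \<open>a + y * g(y)\<close> with \<open>g\<close> nonconstant.
  Since \<open>g\<close> takes each of the values -1, 0, 1 only finitely often,
  \<open>\<bar>g(y)\<bar> \<ge> 2\<close> for all integers \<open>y\<close> outside a finite set,
  and there \<open>\<bar>f(y)\<bar> \<ge> 2 * \<bar>y\<bar> - \<bar>a\<bar>\<close>.\<close>

lemma int_poly_growth:
  fixes f :: "int poly" and c :: int
  assumes "degree f \<ge> 2"
  shows "\<exists>R. \<forall>y. \<bar>y\<bar> \<ge> R \<longrightarrow> \<bar>poly f y\<bar> \<ge> \<bar>y\<bar> + c"
proof -
  obtain a g where f: "f = pCons a g" by (cases f)
  then have g: "degree g \<ge> 1" using assms by (auto split: if_splits)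
  have "finite {y. poly g y = v}" for v
  proof -
    have "g - [:v:] \<noteq> 0" using g by auto
    from poly_roots_finite[OF this] show ?thesis by simp
  qed
  then have "finite (\<Union>v\<in>{-1..1}. {y. poly g y = v})" by blast
  then have fin: "finite {y. \<bar>poly g y\<bar> < 2}"
    by (rule rev_finite_subset) auto
  \<comment> \<open>The maximum plus 1 passes the exceptional points of \<open>g\<close>; the
    summands \<open>\<bar>a\<bar> + \<bar>c\<bar>\<close> turn
    \<open>2 * \<bar>y\<bar> - \<bar>a\<bar>\<close> into at least \<open>\<bar>y\<bar> + c\<close>.
    Inserting 0 keeps the maximum defined and nonnegative.\<close>
  define R where "R = Max (insert 0 (abs ` {y. \<bar>poly g y\<bar> < 2})) + 1 + \<bar>a\<bar> + \<bar>c\<bar>"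
  have "\<bar>poly f y\<bar> \<ge> \<bar>y\<bar> + c" if y: "\<bar>y\<bar> \<ge> R" for y
  proof -
    have M: "Max (insert 0 (abs ` {y. \<bar>poly g y\<bar> < 2})) \<ge> 0" using fin by simp
    have "\<bar>poly g y\<bar> \<ge> 2"
    proof (rule ccontr)
      assume "\<not> ?thesis"
      then have "\<bar>y\<bar> \<le> Max (insert 0 (abs ` {y. \<bar>poly g y\<bar> < 2}))"
        using fin by (intro Max_ge) auto
      then show False using y by (simp add: R_def)
    qed
    then have "\<bar>y * poly g y\<bar> \<ge> \<bar>y\<bar> * 2" unfolding abs_mult by (intro mult_left_mono) auto
    then have "\<bar>poly f y\<bar> \<ge> 2 * \<bar>y\<bar> - \<bar>a\<bar>" unfolding f by simp
    moreover have "\<bar>y\<bar> \<ge> \<bar>a\<bar> + \<bar>c\<bar>" using y M by (simp add: R_def)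
    ultimately show ?thesis by linarith
  qed
  then show ?thesis by blast
qed

text \<open>If the values at times \<open>i < j\<close> coincide, the value at any
  \<open>n \<ge> j\<close> already occurs at time \<open>n - (j - i)\<close>. Descending this way
  confines the orbit to its first \<open>j\<close> values, so it is finite.\<close>

lemma wandering_imp_inj:
  assumes "wandering f t"
  shows "inj (\<lambda>n. (poly f ^^ n) t)"
proof (rule ccontr)
  assume "\<not> ?thesis"
  then obtain i j where ij: "i < j" "(poly f ^^ i) t = (poly f ^^ j) t"
    unfolding inj_def by (metis linorder_neqE_nat)
  have "(poly f ^^ n) t \<in> (\<lambda>n. (poly f ^^ n) t) ` {..<j}" for n
  proof (induction n rule: less_induct)
    case (less n)
    show ?case
    proof (cases "n < j")
      case False
      have "(poly f ^^ n) t = (poly f ^^ ((n - j) + j)) t" using False by simp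
      also have "\<dots> = (poly f ^^ (n - j)) ((poly f ^^ j) t)" by (simp only: funpow_add comp_apply)
      also have "\<dots> = (poly f ^^ ((n - j) + i)) t" by (simp add: ij(2)[symmetric] funpow_add)
      finally show ?thesis using less.IH[of "(n - j) + i"] ij(1) False by simp
    qed auto
  qed
  then have "orb f t \<subseteq> (\<lambda>n. (poly f ^^ n) t) ` {..<j}" by (auto simp: orb_def)
  then show False using assms finite_subset unfolding wandering_def by blast
qed

text \<open>An infinite set of integers leaves the interval from \<open>-R\<close> to
  \<open>R\<close>, and once outside, the growth bound keeps the orbit outside. The margin
  \<open>c\<close> is free because distances from \<open>t\<close> will have to grow as well as
  absolute values.\<close>

lemma orbit_eventually_increasing:
  fixes f :: "int poly" and t c :: int
  assumes "degree f \<ge> 2" "wandering f t" "c \<ge> 0"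
  shows "\<exists>n0. \<forall>n\<ge>n0. \<bar>(poly f ^^ Suc n) t\<bar> \<ge> \<bar>(poly f ^^ n) t\<bar> + c"
proof -
  obtain R where R: "\<And>y. \<bar>y\<bar> \<ge> R \<Longrightarrow> \<bar>poly f y\<bar> \<ge> \<bar>y\<bar> + c"
    using int_poly_growth[OF assms(1)] by blast
  have "\<not> orb f t \<subseteq> {-R..R}"
    using assms(2) finite_subset unfolding wandering_def by blast
  then obtain n0 where "(poly f ^^ n0) t \<notin> {-R..R}" unfolding orb_def by blast
  then have n0: "\<bar>(poly f ^^ n0) t\<bar> \<ge> R" by auto
  have "\<bar>(poly f ^^ n) t\<bar> \<ge> R" if "n \<ge> n0" for n
    using that
  proof (induction n rule: dec_induct)
    case (step n)
    then show ?case using R[of "(poly f ^^ n) t"] assms(3) by simp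
  qed (fact n0)
  then show ?thesis using R by (intro exI[of _ n0]) auto
qed

section \<open>Truncations of eventually increasing sequences\<close>

lemma eventually_increasing_at_top:
  fixes u :: "nat \<Rightarrow> int"
  assumes "\<And>n. n \<ge> n0 \<Longrightarrow> u (Suc n) > u n"
  shows "filterlim u at_top sequentially"
proof -
  have "u n \<ge> u n0 + (int n - int n0)" if "n \<ge> n0" for n
    using that
  proof (induction n rule: dec_induct)
    case (step n)
    then show ?case using assms[of n] by simp
  qed simp
  then have ev: "\<forall>\<^sub>F n in sequentially. u n0 + (int n - int n0) \<le> u n"
    by (auto simp: eventually_sequentially)
  have "filterlim (\<lambda>n. u n0 + (int n - int n0)) at_top sequentially"
    unfolding filterlim_at_top
  proof
    fix Z
    show "\<forall>\<^sub>F n in sequentially. Z \<le> u n0 + (int n - int n0)"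
      using eventually_ge_at_top[of "nat (Z - u n0 + int n0)"]
      by eventually_elim linarith
  qed
  then show ?thesis using ev by (rule filterlim_at_top_mono)
qed

text \<open>\<open>N X\<close> is the first index from \<open>n0\<close> on whose value exceeds
  \<open>X\<close>; monotonicity decides every index from \<open>n0\<close> on. The earlier terms
  are unordered, so the equality is claimed only once \<open>X\<close> is above all of them.\<close>

lemma truncation_eq_initial_segment:
  fixes u :: "nat \<Rightarrow> int"
  assumes "\<And>n. n \<ge> n0 \<Longrightarrow> u (Suc n) > u n"
  obtains N :: "real \<Rightarrow> nat" where "filterlim N at_top at_top"
    "\<forall>\<^sub>F X in at_top. {n. real_of_int (u n) \<le> X} = {..<N X}"
proof -
  define N where "N X = (LEAST n. n \<ge> n0 \<and> real_of_int (u n) > X)" for X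
  have ex: "\<exists>n. n \<ge> n0 \<and> real_of_int (u n) > X" for X
  proof -
    have "\<forall>\<^sub>F n in sequentially. u n \<ge> \<lfloor>X\<rfloor> + 1 \<and> n \<ge> n0"
      using eventually_increasing_at_top[of n0 u] assms unfolding filterlim_at_top
      by (intro eventually_conj eventually_ge_at_top) auto
    then obtain n where "u n \<ge> \<lfloor>X\<rfloor> + 1" "n \<ge> n0"
      using eventually_happens'[OF sequentially_bot] by blast
    then show ?thesis by (intro exI[of _ n]) linarith
  qed
  have N: "N X \<ge> n0" "real_of_int (u (N X)) > X" for X
    using LeastI_ex[OF ex[of X]] by (auto simp: N_def)
  have below: "real_of_int (u n) \<le> X" if "n0 \<le> n" "n < N X" for n X
    using not_less_Least[of n "\<lambda>n. n \<ge> n0 \<and> real_of_int (u n) > X"] that by (auto simp: N_def)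
  have mono: "u n \<ge> u m" if "n \<ge> m" "m \<ge> n0" for m n
    using that
  proof (induction n rule: dec_induct)
    case (step n)
    then show ?case using assms[of n] by simp
  qed simp
  \<comment> \<open>This bound serves twice: \<open>X \<ge> B n0\<close> puts all terms up to
    \<open>n0\<close> below \<open>X\<close>, and \<open>X \<ge> B Z\<close> forces the index
    \<open>N X\<close>, whose value exceeds \<open>X\<close>, beyond \<open>Z\<close>.\<close>
  define B where "B m = Max ((\<lambda>n. real_of_int (u n)) ` {..m})" for m
  have B: "real_of_int (u n) \<le> B m" if "n \<le> m" for n m
    unfolding B_def using that by (intro Max_ge) auto
  show ?thesis
  proof (rule that)
    show "filterlim N at_top at_top"
      unfolding filterlim_at_top
    proof
      fix Z
      show "\<forall>\<^sub>F X in at_top. Z \<le> N X"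
        using eventually_ge_at_top[of "B Z"]
      proof eventually_elim
        case (elim X)
        show ?case
        proof (rule ccontr)
          assume "\<not> ?thesis"
          then have "real_of_int (u (N X)) \<le> B Z" by (intro B) auto
          then show False using N(2)[of X] elim by linarith
        qed
      qed
    qed
    show "\<forall>\<^sub>F X in at_top. {n. real_of_int (u n) \<le> X} = {..<N X}"
      using eventually_ge_at_top[of "B n0"]
    proof eventually_elim
      case (elim X)
      have "real_of_int (u n) \<le> X \<longleftrightarrow> n < N X" for n
      proof
        assume le: "real_of_int (u n) \<le> X"
        show "n < N X"
        proof (rule ccontr)
          assume "\<not> ?thesis"
          then have "u n \<ge> u (N X)" using N(1) by (intro mono) auto
          then show False using le N(2)[of X] by linarith
        qed
      next
        assume "n < N X"
        then show "real_of_int (u n) \<le> X"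
          using below[of n X] B[of n n0] elim by (cases "n0 \<le> n") auto
      qed
      then show ?case by auto
    qed
  qed
qed

text \<open>Since \<open>\<bar>x n\<bar> \<rightarrow> \<infinity>\<close>, the set \<open>{x \<in> orb. x \<le> X}\<close> is finite for every \<open>X\<close> if only finitely many
  \<open>x n\<close> are negative, and infinite for every \<open>X\<close> otherwise; so the same truncation applies for all
  \<open>X\<close>.\<close>

lemma orb_upto_eq_initial_segment:
  fixes f :: "int poly" and t :: int
  assumes "\<And>n. n \<ge> n0 \<Longrightarrow> \<bar>(poly f ^^ Suc n) t\<bar> > \<bar>(poly f ^^ n) t\<bar>"
  obtains N :: "real \<Rightarrow> nat" where "filterlim N at_top at_top"
    "\<forall>\<^sub>F X in at_top. orb_upto (map_poly of_int f) (of_int t) X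
        = (\<lambda>n. of_int ((poly f ^^ n) t)) ` {..<N X}"
proof -
  define x where "x n = (poly f ^^ n) t" for n
  have incr: "\<bar>x (Suc n)\<bar> > \<bar>x n\<bar>" if "n \<ge> n0" for n
    using assms[OF that] by (simp add: x_def)
  have "(poly (map_poly of_int f) ^^ n) (of_int t) = (of_int (x n) :: rat)" for n
    by (induction n) (simp_all add: x_def poly_of_int_map_poly)
  then have orb: "orb (map_poly of_int f) (of_int t) = range (\<lambda>n. of_int (x n) :: rat)"
    by (auto simp: orb_def)
  have le: "{y \<in> range (\<lambda>n. of_int (x n) :: rat). of_rat y \<le> X}
      = (\<lambda>n. of_int (x n)) ` {n. real_of_int (x n) \<le> X}" for X
    by auto
  have abs_le: "{y \<in> range (\<lambda>n. of_int (x n) :: rat). \<bar>of_rat y\<bar> \<le> X}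
      = (\<lambda>n. of_int (x n)) ` {n. real_of_int \<bar>x n\<bar> \<le> X}" for X
    by (auto simp del: abs_of_rat)
  show ?thesis
  proof (cases "finite {n. x n < 0}")
    case True
    then obtain n1 where n1: "\<And>n. x n < 0 \<Longrightarrow> n < n1"
      using finite_nat_set_iff_bounded by auto
    \<comment> \<open>Once the terms are nonnegative, growth in absolute value is growth.\<close>
    have "x (Suc n) > x n" if "n \<ge> max n0 n1" for n
      using incr[of n] n1[of n] n1[of "Suc n"] that by force
    then obtain N where N: "filterlim N at_top at_top"
      "\<forall>\<^sub>F X in at_top. {n. real_of_int (x n) \<le> X} = {..<N X}"
      by (rule truncation_eq_initial_segment)
    show ?thesis
    proof (rule that[OF N(1)])
      show "\<forall>\<^sub>F X in at_top. orb_upto (map_poly of_int f) (of_int t) X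
          = (\<lambda>n. of_int ((poly f ^^ n) t)) ` {..<N X}"
        using N(2) unfolding x_def[symmetric]
        by eventually_elim (simp only: orb_upto_def orb le finite_imageI finite_lessThan if_True)
    qed
  next
    case False
    have inf: "infinite ((\<lambda>n. of_int (x n) :: rat) ` {n. real_of_int (x n) \<le> X})" for X
    proof
      assume fin: "finite ((\<lambda>n. of_int (x n) :: rat) ` {n. real_of_int (x n) \<le> X})"
      obtain n1 where n1: "\<And>n. n \<ge> n1 \<Longrightarrow> \<bar>x n\<bar> \<ge> \<bar>\<lfloor>X\<rfloor>\<bar> + 1"
        using eventually_increasing_at_top[of n0 "\<lambda>n. \<bar>x n\<bar>"] incr
        unfolding filterlim_at_top eventually_sequentially by meson
      \<comment> \<open>A negative term of absolute value above
        \<open>\<bar>\<lfloor>X\<rfloor>\<bar>\<close> lies below \<open>X\<close>. Restricting to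
        indices from \<open>n0\<close> on, where \<open>x\<close> is injective, turns infinitely
        many indices into infinitely many values.\<close>
      have "{n. x n < 0} - {..<max n0 n1} \<subseteq> {n. real_of_int (x n) \<le> X} \<inter> {n0..}"
      proof
        fix n assume n: "n \<in> {n. x n < 0} - {..<max n0 n1}"
        then have "x n \<le> \<lfloor>X\<rfloor>" using n1[of n] by force
        then show "n \<in> {n. real_of_int (x n) \<le> X} \<inter> {n0..}"
          using n by (auto simp: le_floor_iff)
      qed
      moreover have "infinite ({n. x n < 0} - {..<max n0 n1})" using False by simp
      ultimately have inf: "infinite ({n. real_of_int (x n) \<le> X} \<inter> {n0..})"
        using finite_subset by blast
      have less: "\<bar>x m\<bar> < \<bar>x n\<bar>" if "n0 \<le> m" "m < n" for m n
        using that(2,1) by (induction n rule: less_Suc_induct) (use incr in force)+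
      have "inj_on x {n0..}"
        by (rule linorder_inj_onI) (use less in force)+
      then have "inj_on (\<lambda>n. of_int (x n) :: rat) ({n. real_of_int (x n) \<le> X} \<inter> {n0..})"
        by (auto simp: inj_on_def)
      then have "infinite ((\<lambda>n. of_int (x n) :: rat) ` ({n. real_of_int (x n) \<le> X} \<inter> {n0..}))"
        using inf finite_image_iff by blast
      then show False using fin by (meson Int_lower1 finite_subset image_mono)
    qed
    obtain N where N: "filterlim N at_top at_top"
      "\<forall>\<^sub>F X in at_top. {n. real_of_int \<bar>x n\<bar> \<le> X} = {..<N X}"
      using truncation_eq_initial_segment[of n0 "\<lambda>n. \<bar>x n\<bar>"] incr by blast
    show ?thesis
    proof (rule that[OF N(1)])
      show "\<forall>\<^sub>F X in at_top. orb_upto (map_poly of_int f) (of_int t) X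
          = (\<lambda>n. of_int ((poly f ^^ n) t)) ` {..<N X}"
        using N(2) unfolding x_def[symmetric]
        by eventually_elim (simp only: orb_upto_def orb le abs_le inf if_False)
    qed
  qed
qed

text \<open>A wandering orbit has no repetitions, so counting orbit points amounts to counting
  indices. For large \<open>X\<close> the truncation is the initial segment of length
  \<open>N X\<close>, and the index limit is composed with \<open>N X\<close> tending to
  infinity.\<close>

lemma has_orb_densityI:
  fixes f :: "int poly" and t :: int and A :: "rat set"
  assumes "degree f \<ge> 2" "wandering f t"
    and lim: "(\<lambda>N. real (card {n. n < N \<and> of_int ((poly f ^^ n) t) \<in> A}) / real N) \<longlonglongrightarrow> d"
  shows "has_orb_density (map_poly of_int f) (of_int t) A d"
proof -
  define y where "y n = (of_int ((poly f ^^ n) t) :: rat)" for n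
  obtain n0 where "\<And>n. n \<ge> n0 \<Longrightarrow> \<bar>(poly f ^^ Suc n) t\<bar> \<ge> \<bar>(poly f ^^ n) t\<bar> + 1"
    using orbit_eventually_increasing[OF assms(1,2), of 1] by auto
  then have "\<And>n. n \<ge> n0 \<Longrightarrow> \<bar>(poly f ^^ Suc n) t\<bar> > \<bar>(poly f ^^ n) t\<bar>"
    by force
  then obtain N where N: "filterlim N at_top at_top"
    "\<forall>\<^sub>F X in at_top. orb_upto (map_poly of_int f) (of_int t) X = y ` {..<N X}"
    unfolding y_def by (rule orb_upto_eq_initial_segment)
  have inj: "inj y"
    using wandering_imp_inj[OF assms(2)] by (auto simp: y_def inj_def)
  have c1: "card (A \<inter> y ` {..<m}) = card {n. n < m \<and> y n \<in> A}" for m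
  proof -
    have "A \<inter> y ` {..<m} = y ` {n. n < m \<and> y n \<in> A}" by auto
    then show ?thesis using inj by (simp add: card_image inj_on_subset)
  qed
  have c2: "card (y ` {..<m}) = m" for m
    using inj by (simp add: card_image inj_on_subset)
  have "((\<lambda>X. real (card {n. n < N X \<and> y n \<in> A}) / real (N X)) \<longlongrightarrow> d) at_top"
    using filterlim_compose[OF lim N(1)] by (simp add: y_def)
  moreover have "\<forall>\<^sub>F X in at_top.
      real (card {n. n < N X \<and> y n \<in> A}) / real (N X) =
      real (card (A \<inter> orb_upto (map_poly of_int f) (of_int t) X)) /
      real (card (orb_upto (map_poly of_int f) (of_int t) X))"
    using N(2) by eventually_elim (simp add: c1 c2)
  ultimately show ?thesis
    unfolding has_orb_density_def by (rule Lim_transform_eventually)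
qed

section \<open>Exact periods modulo differences of orbit points\<close>

text \<open>Modulo \<open>f\<^sup>m(t) - t\<close> the orbit is periodic with period dividing \<open>m\<close>; for large \<open>m\<close> a smaller
  period is excluded by size.\<close>

lemma orbit_difference_dvd_iff:
  fixes f :: "int poly" and t :: int
  assumes "degree f \<ge> 2" "wandering f t"
  shows "\<exists>M. \<forall>m\<ge>M. \<forall>n. (poly f ^^ m) t - t dvd (poly f ^^ n) t - t \<longleftrightarrow> m dvd n"
proof -
  define x where "x n = (poly f ^^ n) t" for n
  have x0: "x 0 = t" by (simp add: x_def)
  have x_add: "x (i + j) = (poly f ^^ i) (x j)" for i j
    by (simp add: x_def funpow_add)
  have inj: "inj x" using wandering_imp_inj[OF assms(2)] by (simp add: x_def[abs_def])
  \<comment> \<open>The margin \<open>2 * \<bar>t\<bar> + 1\<close> absorbs two triangle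
    inequalities, so that the distance from \<open>t\<close> increases strictly as well.\<close>
  obtain n0 where "\<And>n. n \<ge> n0 \<Longrightarrow> \<bar>x (Suc n)\<bar> \<ge> \<bar>x n\<bar> + (2 * \<bar>t\<bar> + 1)"
    using orbit_eventually_increasing[OF assms, of "2 * \<bar>t\<bar> + 1"] by (auto simp: x_def)
  then have incr: "\<bar>x (Suc n) - t\<bar> > \<bar>x n - t\<bar>" if "n \<ge> n0" for n
    using that by force
  \<comment> \<open>Strict growth says nothing about indices up to \<open>n0\<close>;
    \<open>M\<close> is taken so late that the distance from \<open>t\<close> also beats all of
    these.\<close>
  define B where "B = Max ((\<lambda>n. \<bar>x n - t\<bar>) ` {..n0})"
  have B: "\<bar>x n - t\<bar> \<le> B" if "n \<le> n0" for n
    unfolding B_def using that by (intro Max_ge) auto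
  obtain M where M: "\<And>n. n \<ge> M \<Longrightarrow> \<bar>x n - t\<bar> \<ge> B + 1"
    using eventually_increasing_at_top[of n0 "\<lambda>n. \<bar>x n - t\<bar>"] incr
    unfolding filterlim_at_top eventually_sequentially by meson
  have less: "\<bar>x r - t\<bar> < \<bar>x m - t\<bar>" if "r < m" "m \<ge> M" for r m
  proof (cases "r \<le> n0")
    case True
    then show ?thesis using B[of r] M[of m] that by linarith
  next
    case False
    then have "n0 \<le> r" by simp
    with \<open>r < m\<close> show ?thesis
      by (induction m rule: less_Suc_induct) (use incr in force)+
  qed
  \<comment> \<open>\<open>Suc M\<close> in place of \<open>M\<close> makes \<open>m\<close>
    positive, so that the remainder \<open>n mod m\<close> is less than \<open>m\<close>.\<close>
  have "x m - t dvd x n - t \<longleftrightarrow> m dvd n" if m: "m \<ge> Suc M" for m n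
  proof -
    define a where "a = x m - t"
    have mult: "a dvd x (q * m) - t" for q
    proof (induction q)
      case (Suc q)
      have "a dvd (poly f ^^ m) (x (q * m)) - (poly f ^^ m) t"
        using Suc by (rule minus_dvd_poly_funpow_minus)
      then have "a dvd x (Suc q * m) - x m"
        by (simp add: x_add x_def[of m, symmetric])
      then have "a dvd (x (Suc q * m) - x m) + (x m - t)"
        by (rule dvd_add) (simp add: a_def)
      then show ?case by simp
    qed (simp add: x0)
    have "m dvd n" if "a dvd x n - t"
    proof -
      define r where "r = n mod m"
      have "n = r + (n div m) * m" by (simp add: r_def)
      then have "x n = (poly f ^^ r) (x ((n div m) * m))" using x_add by metis
      then have "a dvd x n - x r"
        using minus_dvd_poly_funpow_minus[OF mult] by (simp add: x_def[of r])
      then have "a dvd (x n - t) - (x n - x r)" using that by (rule dvd_diff[rotated])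
      then have "a dvd x r - t" by simp
      \<comment> \<open>A multiple of \<open>a\<close> smaller than \<open>a\<close> in absolute
        value is 0, so the orbit would be back at \<open>t\<close> at time \<open>r\<close>;
        injectivity then leaves only \<open>r = 0\<close>.\<close>
      moreover have "\<bar>x r - t\<bar> < \<bar>a\<bar>"
        unfolding a_def using m by (intro less) (auto simp: r_def)
      ultimately have "x r - t = 0"
        using dvd_imp_le_int by (metis linorder_not_less)
      then have "x r = x 0" by (simp add: x0)
      then have "r = 0" using inj by (simp add: inj_eq)
      then show ?thesis by (auto simp: r_def)
    qed
    moreover have "a dvd x n - t" if "m dvd n"
      using that mult by (auto simp: mult.commute elim!: dvdE)
    ultimately show ?thesis by (auto simp: a_def)
  qed
  then show ?thesis unfolding x_def by blast
qed

section \<open>Orbits of translations as residue classes, and the density of their union\<close>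

lemma of_int_in_orb_pm_translation_iff:
  "of_int y \<in> orb_pm (map_poly of_int [:a, 1:]) (of_int t) \<longleftrightarrow> a dvd y - t"
proof -
  have "map_poly of_int [:a, 1:] = [:of_int a, 1 :: rat:]"
    by (simp add: map_poly_pCons)
  then have "of_int y \<in> orb_pm (map_poly of_int [:a, 1:]) (of_int t) \<longleftrightarrow>
      (\<exists>n. (of_int y :: rat) = of_int (t + n * a))"
    by (simp add: orb_pm_translation)
  also have "\<dots> \<longleftrightarrow> (\<exists>n. y - t = a * n)"
    by (simp only: of_int_eq_iff) (auto simp: algebra_simps)
  finally show ?thesis by (simp add: dvd_def)
qed

theorem theorem6p9:
  fixes f :: "int poly" and t :: int and \<epsilon> :: real
  assumes "degree f \<ge> 2"
    and "wandering f t"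
    and "\<epsilon> > 0"
  shows "\<exists>(k::nat) (g :: nat \<Rightarrow> int poly). k > 1 \<and> (\<forall>i\<in>{1..k}. degree (g i) = 1) \<and>
    (\<exists>d. has_orb_density (map_poly of_int f) (of_int t)
           (\<Union>i\<in>{1..k}. orb_pm (map_poly of_int (g i)) (of_int t)) d
         \<and> 1 - \<epsilon> \<le> d \<and> d < 1)"
proof -
  define x where "x n = (poly f ^^ n) t" for n
  obtain M where M: "\<And>m n. m \<ge> M \<Longrightarrow> x m - t dvd x n - t \<longleftrightarrow> m dvd n"
    using orbit_difference_dvd_iff[OF assms(1,2)] unfolding x_def by blast
  \<comment> \<open>The bound by \<open>\<epsilon>\<close> gives the lower estimate for the density;
    the bound by 1 makes \<open>P\<close> nonempty, since the empty product equals 1.\<close>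
  obtain P where P: "finite P" "\<And>p. p \<in> P \<Longrightarrow> prime p" "\<And>p. p \<in> P \<Longrightarrow> p \<ge> M"
      "(\<Prod>p\<in>P. 1 - 1 / real p) < min \<epsilon> 1"
    using ex_primes_prod_less[of "min \<epsilon> 1" M] assms(3) by auto
  then obtain p0 where p0: "p0 \<in> P" by fastforce
  define d where "d = 1 - (\<Prod>p\<in>P. 1 - 1 / real p)"
  have pos: "(\<Prod>p\<in>P. 1 - 1 / real p) > 0"
    using prime_gt_1_nat[OF P(2)] by (intro prod_pos) fastforce
  \<comment> \<open>Each prime in \<open>P\<close> serves as its own index, which spares an
    enumeration of \<open>P\<close> and gives \<open>k > 1\<close> even when \<open>P\<close> has a
    single element.\<close>
  define k where "k = Max P"
  have P_le: "p \<in> {1..k}" if "p \<in> P" for p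
    using that P(1) prime_ge_1_nat[OF P(2)[OF that]] by (auto simp: k_def)
  have k: "k > 1" using P_le[OF p0] prime_gt_1_nat[OF P(2)[OF p0]] by simp
  \<comment> \<open>The indices outside \<open>P\<close> are padded with the polynomial of \<open>p0\<close>.\<close>
  define s where "s i = (if i \<in> P then i else p0)" for i
  define g where "g i = [:x (s i) - t, 1:]" for i
  have s: "s ` {1..k} = P"
    using p0 P_le by (force simp: s_def)
  define A where "A = (\<Union>i\<in>{1..k}. orb_pm (map_poly of_int (g i)) (of_int t))"
  have "of_int (x n) \<in> A \<longleftrightarrow> (\<exists>p\<in>P. p dvd n)" for n
  proof -
    have "of_int (x n) \<in> A \<longleftrightarrow> (\<exists>i\<in>{1..k}. x (s i) - t dvd x n - t)"
      by (simp add: A_def g_def of_int_in_orb_pm_translation_iff del: map_poly_pCons)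
    also have "\<dots> \<longleftrightarrow> (\<exists>p\<in>P. x p - t dvd x n - t)"
      unfolding s[symmetric] by blast
    also have "\<dots> \<longleftrightarrow> (\<exists>p\<in>P. p dvd n)" using M P(3) by blast
    finally show ?thesis .
  qed
  then have "(\<lambda>N. real (card {n. n < N \<and> of_int (x n) \<in> A}) / real N) \<longlonglongrightarrow> d"
    using density_multiples_of_primes[of P] P(1,2) p0 by (auto simp: d_def)
  then have "has_orb_density (map_poly of_int f) (of_int t) A d"
    unfolding x_def by (rule has_orb_densityI[OF assms(1,2)])
  moreover have "degree (g i) = 1" for i by (simp add: g_def)
  moreover have "1 - \<epsilon> \<le> d" "d < 1" using P(4) pos by (auto simp: d_def)
  ultimately show ?thesis using k unfolding A_def by blast
qed

end
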